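(* Let $G$ and $H$ be Polish groups, let $\psi: G \to H$ be a normal compression, and let $G \rtimes_{\psi} H$ be the semidirect product associated to the $\psi$-equivariant action of $H$ on $G$, equipped with the product topology. Then: (1) $G \rtimes_{\psi} H$ is a Polish topological group. (2) The map $\pi: G\rtimes_{\psi}H\to H$, $(g,h)\mapsto \psi(g)h$, is a continuous surjective homomorphism, $\ker(\pi)=\{(g^{-1},\psi(g))\mid g\in G\}$, and $\ker(\pi)\simeq G$ as topological groups. (3) $\psi = \pi \circ \iota$, where $\iota: G \to G\rtimes_{\psi}H$ is the usual inclusion $g \mapsto (g,1)$. (4) $G\rtimes_{\psi}H =\overline{\iota(G)\ker (\pi)}$, and the subgroups $\iota(G)$ and $\ker(\pi)$ are closed normal subgroups of $G\rtimes_{\psi}H$ with trivial intersection.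
   Context: A Polish group is a topological group whose topology is separable and completely metrizable. A normal compression between topological groups is a continuous injective homomorphism $\psi: G\to H$ whose image is dense and normal in $H$. The $\psi$-equivariant action of $H$ on $G$ is the action by abstract group automorphisms $h.g := \psi^{-1}(h\psi(g)h^{-1})$; it is the unique action such that $\psi(h.g)=h\psi(g)h^{-1}$ for all $g\in G$, $h\in H$. The group $G\rtimes_\psi H$ is the set $G\times H$ with multiplication $(g,h)(g',h') = (g\,(h.g'),hh')$. *)

theory Defs
  imports "HOL-Analysis.Analysis" "HOL-Algebra.Coset"
begin

definition topological_group :: "('a, 'm) monoid_scheme \<Rightarrow> 'a topology \<Rightarrow> bool" where
  "topological_group G T \<longleftrightarrow>
     group G \<and> topspace T = carrier G \<and>
     continuous_map (prod_topology T T) T (\<lambda>(x, y). x \<otimes>\<^bsub>G\<^esub> y) \<and>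
     continuous_map T T (\<lambda>x. inv\<^bsub>G\<^esub> x)"

definition polish_group :: "('a, 'm) monoid_scheme \<Rightarrow> 'a topology \<Rightarrow> bool" where
  "polish_group G T \<longleftrightarrow>
     topological_group G T \<and> separable_space T \<and> completely_metrizable_space T"

definition isomorphic_topological_groups ::
    "('a, 'm) monoid_scheme \<Rightarrow> 'a topology \<Rightarrow> ('b, 'n) monoid_scheme \<Rightarrow> 'b topology \<Rightarrow> bool" where
  "isomorphic_topological_groups G S H T \<longleftrightarrow> (\<exists>f. f \<in> iso G H \<and> homeomorphic_map S T f)"

definition normal_compression ::
    "('a, 'm) monoid_scheme \<Rightarrow> 'a topology \<Rightarrow> ('b, 'n) monoid_scheme \<Rightarrow> 'b topology \<Rightarrow>
     ('a \<Rightarrow> 'b) \<Rightarrow> bool" where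
  "normal_compression G S H T \<psi> \<longleftrightarrow>
     continuous_map S T \<psi> \<and> \<psi> \<in> hom G H \<and> inj_on \<psi> (carrier G) \<and>
     T closure_of (\<psi> ` carrier G) = topspace T \<and> (\<psi> ` carrier G) \<lhd> H"

text \<open>The inverse of \<open>\<psi>\<close> is taken on the carrier of \<open>G\<close>; it is only ever applied to elements
  of the image of \<open>\<psi>\<close>, because that image is normal in \<open>H\<close>.\<close>

definition equivariant_action ::
    "('a, 'm) monoid_scheme \<Rightarrow> ('b, 'n) monoid_scheme \<Rightarrow> ('a \<Rightarrow> 'b) \<Rightarrow> 'b \<Rightarrow> 'a \<Rightarrow> 'a" where
  "equivariant_action G H \<psi> h g =
     inv_into (carrier G) \<psi> (h \<otimes>\<^bsub>H\<^esub> \<psi> g \<otimes>\<^bsub>H\<^esub> inv\<^bsub>H\<^esub> h)"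

lemma equivariant_action:
  assumes "normal_compression G S H T \<psi>" "g \<in> carrier G" "h \<in> carrier H"
  shows "equivariant_action G H \<psi> h g \<in> carrier G"
    and "\<psi> (equivariant_action G H \<psi> h g) = h \<otimes>\<^bsub>H\<^esub> \<psi> g \<otimes>\<^bsub>H\<^esub> inv\<^bsub>H\<^esub> h"
proof -
  have "h \<otimes>\<^bsub>H\<^esub> \<psi> g \<otimes>\<^bsub>H\<^esub> inv\<^bsub>H\<^esub> h \<in> \<psi> ` carrier G"
    using assms by (simp add: normal_compression_def normal.inv_op_closed2)
  then show "equivariant_action G H \<psi> h g \<in> carrier G"
    and "\<psi> (equivariant_action G H \<psi> h g) = h \<otimes>\<^bsub>H\<^esub> \<psi> g \<otimes>\<^bsub>H\<^esub> inv\<^bsub>H\<^esub> h"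
    by (simp_all add: equivariant_action_def inv_into_into f_inv_into_f)
qed

definition semidirect ::
    "('a, 'm) monoid_scheme \<Rightarrow> ('b, 'n) monoid_scheme \<Rightarrow> ('a \<Rightarrow> 'b) \<Rightarrow> ('a \<times> 'b) monoid" where
  "semidirect G H \<psi> =
     \<lparr>carrier = carrier G \<times> carrier H,
      monoid.mult = (\<lambda>(g, h) (g', h'). (g \<otimes>\<^bsub>G\<^esub> equivariant_action G H \<psi> h g', h \<otimes>\<^bsub>H\<^esub> h')),
      one = (\<one>\<^bsub>G\<^esub>, \<one>\<^bsub>H\<^esub>)\<rparr>"

definition semidirect_proj :: "('b, 'n) monoid_scheme \<Rightarrow> ('a \<Rightarrow> 'b) \<Rightarrow> 'a \<times> 'b \<Rightarrow> 'b" where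
  "semidirect_proj H \<psi> = (\<lambda>(g, h). \<psi> g \<otimes>\<^bsub>H\<^esub> h)"

definition semidirect_incl :: "('b, 'n) monoid_scheme \<Rightarrow> 'a \<Rightarrow> 'a \<times> 'b" where
  "semidirect_incl H = (\<lambda>g. (g, \<one>\<^bsub>H\<^esub>))"

end

theory Submission
  imports Defs
begin

text \<open>
  Write \<open>h.g\<close> for the \<open>\<psi>\<close>-equivariant action. The algebraic claims follow by applying the injective
  homomorphism \<open>\<psi>\<close>, which turns the action into conjugation in \<open>H\<close>. The substance of the theorem is
  that the product topology is a group topology on \<open>G \<times> H\<close>, in other words that \<open>(h, g) \<mapsto> h.g\<close> is
  jointly continuous. The action is defined through the inverse of \<open>\<psi>\<close>, which in general is not
  continuous, so this is an automatic continuity statement and has to use that the groups are Polish.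

  What comes for free is that the maps involved have closed graph: they become continuous after
  composition with the continuous injection \<open>\<psi>\<close> (\<open>closed_graph_if_injection_comp_continuous\<close>). A map
  with closed graph between Polish spaces is continuous off a meagre set
  (\<open>closed_graph_continuous_off_meagre\<close>). This rests on a Baire category version of Lusin's separation
  theorem: if two closed subsets of a Polish space have disjoint images under a continuous map, then
  an open set separates these images up to a meagre set (\<open>category_separated_images\<close>).

  If the domain of the map is moreover a group with continuous translations and the map is
  equivariant, so that its value at \<open>x\<close> is a continuous function of its value at \<open>k x\<close>, then a generic \<open>k\<close>
  moves a given convergent sequence together with its limit off the meagre set, and continuity
  everywhere follows (\<open>equivariant_closed_graph_imp_continuous\<close>). This principle is used three times:
  for \<open>g \<mapsto> h.g\<close> on \<open>G\<close>, for \<open>h \<mapsto> h.g\<close> on \<open>H\<close>, and for the inversion of \<open>G \<rtimes> H\<close>. The first two uses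
  say that the action is separately continuous, which makes the left and right translations of
  \<open>G \<rtimes> H\<close> continuous and thereby permits the third use. Joint continuity is then read off from
  \<open>(g, h)\<inverse> = (h\<inverse>.g\<inverse>, h\<inverse>)\<close>.
\<close>

section \<open>Meagre sets and separation up to meagre sets\<close>

definition meagre_in :: "'a topology \<Rightarrow> 'a set \<Rightarrow> bool" where
  "meagre_in X M \<longleftrightarrow>
     (\<exists>\<C>. countable \<C> \<and> (\<forall>C\<in>\<C>. closedin X C \<and> X interior_of C = {}) \<and> M \<subseteq> \<Union>\<C>)"

lemma meagre_in_subset: "meagre_in X M \<Longrightarrow> N \<subseteq> M \<Longrightarrow> meagre_in X N"
  unfolding meagre_in_def by (meson order_trans)

lemma meagre_in_empty: "meagre_in X {}"
  unfolding meagre_in_def by (rule exI[of _ "{}"]) auto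

lemma meagre_in_UN:
  assumes "countable I" "\<And>i. i \<in> I \<Longrightarrow> meagre_in X (M i)"
  shows "meagre_in X (\<Union>i\<in>I. M i)"
proof -
  have "\<forall>i\<in>I. \<exists>\<C>. countable \<C> \<and> (\<forall>C\<in>\<C>. closedin X C \<and> X interior_of C = {}) \<and> M i \<subseteq> \<Union>\<C>"
    using assms(2) by (simp add: meagre_in_def)
  then obtain \<C> where "\<forall>i\<in>I. countable (\<C> i) \<and>
      (\<forall>C\<in>\<C> i. closedin X C \<and> X interior_of C = {}) \<and> M i \<subseteq> \<Union>(\<C> i)"
    by metis
  then show ?thesis
    unfolding meagre_in_def using \<open>countable I\<close>
    by (intro exI[of _ "\<Union>i\<in>I. \<C> i"]) (auto, blast)
qed

lemma meagre_in_Un: "meagre_in X M \<Longrightarrow> meagre_in X N \<Longrightarrow> meagre_in X (M \<union> N)"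
  using meagre_in_UN[of "{True, False}" X "\<lambda>b. if b then M else N"]
  by (auto simp: Un_commute)

text \<open>
  An open set inside the frontier of \<open>U\<close> misses \<open>U\<close>, hence also misses the closure of \<open>U\<close>.
\<close>

lemma meagre_in_frontier_of_openin:
  assumes "openin X U" shows "meagre_in X (X frontier_of U)"
proof -
  have eq: "X frontier_of U = X closure_of U - U"
    using assms by (simp add: frontier_of_def interior_of_openin)
  then have "U \<inter> X interior_of (X frontier_of U) = {}"
    using interior_of_subset by fastforce
  then have "X closure_of U \<inter> X interior_of (X frontier_of U) = {}"
    by (metis Int_commute openin_Int_closure_of_eq_empty openin_interior_of)
  then have "X interior_of (X frontier_of U) = {}"
    using eq interior_of_subset by fastforce
  then show ?thesis
    unfolding meagre_in_def
    by (intro exI[of _ "{X frontier_of U}"]) (auto simp: closedin_frontier_of)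
qed

lemma meagre_in_homeomorphic_image:
  assumes "homeomorphic_map X Y f" "meagre_in X M" "M \<subseteq> topspace X"
  shows "meagre_in Y (f ` M)"
proof -
  obtain \<C> where \<C>: "countable \<C>" "\<And>C. C \<in> \<C> \<Longrightarrow> closedin X C \<and> X interior_of C = {}" "M \<subseteq> \<Union>\<C>"
    using assms(2) by (auto simp: meagre_in_def)
  have "closedin Y (f ` C) \<and> Y interior_of (f ` C) = {}" if "C \<in> \<C>" for C
    using that \<C>(2)[OF that] assms(1)
    by (metis closedin_subset homeomorphic_map_closedness homeomorphic_map_interior_of image_is_empty)
  then show ?thesis
    unfolding meagre_in_def using \<C>(1,3) by (intro exI[of _ "(`) f ` \<C>"]) (auto, blast)
qed

lemma completely_metrizable_not_meagre:
  assumes "completely_metrizable_space X" "meagre_in X M" "topspace X \<noteq> {}"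
  shows "\<exists>x\<in>topspace X. x \<notin> M"
proof (rule ccontr)
  assume contr: "\<not> ?thesis"
  obtain \<C> where \<C>: "countable \<C>" "\<And>C. C \<in> \<C> \<Longrightarrow> closedin X C \<and> X interior_of C = {}" "M \<subseteq> \<Union>\<C>"
    using assms(2) by (auto simp: meagre_in_def)
  have "X interior_of \<Union>\<C> = {}"
    using Baire_category_alt[OF disjI1[OF assms(1)] \<C>(1)] \<C>(2) by blast
  moreover have "topspace X = \<Union>\<C>"
  proof
    show "topspace X \<subseteq> \<Union>\<C>"
      using contr \<C>(3) by blast
    show "\<Union>\<C> \<subseteq> topspace X"
      using \<C>(2) closedin_subset by blast
  qed
  ultimately show False
    using assms(3) by (metis interior_of_topspace)
qed

text \<open>
  Up to a meagre set, an open set contains \<open>A\<close> and misses \<open>B\<close>. Sets with the Baire property are open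
  up to a meagre set, so this is separation by such a set, as far as category can tell.
\<close>

definition category_separated :: "'a topology \<Rightarrow> 'a set \<Rightarrow> 'a set \<Rightarrow> bool" where
  "category_separated X A B \<longleftrightarrow>
     (\<exists>U M. openin X U \<and> meagre_in X M \<and> A \<subseteq> U \<union> M \<and> B \<inter> U \<subseteq> M)"

text \<open>
  The exterior of a separating open set separates the other way round; the exceptional set grows by
  the frontier, which is meagre.
\<close>

lemma category_separated_sym:
  assumes "category_separated X A B" "B \<subseteq> topspace X"
  shows "category_separated X B A"
proof -
  obtain U M where U: "openin X U" and M: "meagre_in X M" and "A \<subseteq> U \<union> M" "B \<inter> U \<subseteq> M"
    using assms(1) by (auto simp: category_separated_def)
  moreover have "X frontier_of U = X closure_of U - U"
    using U by (simp add: frontier_of_def interior_of_openin)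
  ultimately have "B \<subseteq> (topspace X - X closure_of U) \<union> (M \<union> X frontier_of U)"
    and "A \<inter> (topspace X - X closure_of U) \<subseteq> M \<union> X frontier_of U"
    using assms(2) closure_of_subset[OF openin_subset[OF U]] by auto
  then show ?thesis
    unfolding category_separated_def using M U
    by (metis closedin_closure_of meagre_in_Un meagre_in_frontier_of_openin openin_diff
        openin_topspace)
qed

lemma category_separated_UN_left:
  assumes "countable I" "\<And>i. i \<in> I \<Longrightarrow> category_separated X (A i) B"
  shows "category_separated X (\<Union>i\<in>I. A i) B"
proof -
  have "\<forall>i\<in>I. \<exists>U M. openin X U \<and> meagre_in X M \<and> A i \<subseteq> U \<union> M \<and> B \<inter> U \<subseteq> M"
    using assms(2) by (simp add: category_separated_def)
  then obtain U M where UM: "\<forall>i\<in>I. openin X (U i) \<and> meagre_in X (M i) \<and>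
      A i \<subseteq> U i \<union> M i \<and> B \<inter> U i \<subseteq> M i"
    by metis
  have "openin X (\<Union>i\<in>I. U i)" "meagre_in X (\<Union>i\<in>I. M i)"
    using UM assms(1) by (auto intro: meagre_in_UN)
  moreover have "(\<Union>i\<in>I. A i) \<subseteq> (\<Union>i\<in>I. U i) \<union> (\<Union>i\<in>I. M i)" "B \<inter> (\<Union>i\<in>I. U i) \<subseteq> (\<Union>i\<in>I. M i)"
    using UM by blast+
  ultimately show ?thesis
    unfolding category_separated_def by blast
qed

lemma category_separated_UN:
  assumes "countable I" "countable J"
    and sep: "\<And>i j. i \<in> I \<Longrightarrow> j \<in> J \<Longrightarrow> category_separated X (A i) (B j)"
    and "\<And>i. i \<in> I \<Longrightarrow> A i \<subseteq> topspace X" "\<And>j. j \<in> J \<Longrightarrow> B j \<subseteq> topspace X"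
  shows "category_separated X (\<Union>i\<in>I. A i) (\<Union>j\<in>J. B j)"
proof (rule category_separated_UN_left[OF \<open>countable I\<close>])
  fix i assume i: "i \<in> I"
  have "category_separated X (\<Union>j\<in>J. B j) (A i)"
    using assms i by (intro category_separated_UN_left category_separated_sym[OF sep]) auto
  then show "category_separated X (A i) (\<Union>j\<in>J. B j)"
    using assms(4)[OF i] by (rule category_separated_sym)
qed

section \<open>Maps with closed graph between Polish spaces\<close>

lemma separable_space_prod_topology:
  assumes "separable_space X" "separable_space Y"
  shows "separable_space (prod_topology X Y)"
proof -
  obtain C D where "countable C" "C \<subseteq> topspace X" "X closure_of C = topspace X"
    and "countable D" "D \<subseteq> topspace Y" "Y closure_of D = topspace Y"
    using assms by (auto simp: separable_space_def)
  then show ?thesis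
    unfolding separable_space_def
    by (intro exI[of _ "C \<times> D"]) (auto simp: closure_of_Times)
qed

lemma (in Metric_space) countable_cover_mcball:
  assumes "countable D" "mtopology closure_of D = M" "\<epsilon> > 0"
  shows "M \<subseteq> (\<Union>x\<in>D. mcball x \<epsilon>)"
proof
  fix y assume "y \<in> M"
  then obtain x where "x \<in> D" "x \<in> mball y \<epsilon>"
    using assms unfolding metric_closure_of by blast
  then have "y \<in> mcball x \<epsilon>"
    using commute[of x y] by auto
  then show "y \<in> (\<Union>x\<in>D. mcball x \<epsilon>)"
    using \<open>x \<in> D\<close> by blast
qed

lemma separable_metrizable_imp_second_countable:
  assumes "metrizable_space X" "separable_space X"
  shows "second_countable X"
proof -
  obtain M d where "Metric_space M d" and X: "X = Metric_space.mtopology M d"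
    using assms(1) by (auto simp: metrizable_space_def)
  then interpret Metric_space M d by simp
  obtain D where D: "countable D" "D \<subseteq> M" "mtopology closure_of D = M"
    using assms(2) by (auto simp: separable_space_def X)
  define \<B> where "\<B> = (\<lambda>(x, n). mball x (inverse (real (Suc n)))) ` (D \<times> UNIV)"
  have "\<exists>V\<in>\<B>. y \<in> V \<and> V \<subseteq> U" if U: "openin mtopology U" "y \<in> U" for U y
  proof -
    obtain r where r: "r > 0" "mball y r \<subseteq> U" and "y \<in> M"
      using U unfolding openin_mtopology by blast
    obtain n where n: "inverse (real (Suc n)) < r / 2"
      using r(1) reals_Archimedean half_gt_zero by blast
    have "y \<in> mtopology closure_of D" "inverse (real (Suc n)) > 0"
      using D \<open>y \<in> M\<close> by simp_all
    then obtain x where "x \<in> D" "x \<in> mball y (inverse (real (Suc n)))"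
      unfolding metric_closure_of by blast
    then have x: "x \<in> D" "x \<in> M" "d y x < inverse (real (Suc n))"
      by auto
    have "mball x (inverse (real (Suc n))) \<subseteq> mball y r"
    proof
      fix z assume z: "z \<in> mball x (inverse (real (Suc n)))"
      then have "d y z \<le> d y x + d x z"
        using triangle[of y x z] \<open>y \<in> M\<close> x by simp
      then show "z \<in> mball y r"
        using x n z \<open>y \<in> M\<close> by simp
    qed
    moreover have "y \<in> mball x (inverse (real (Suc n)))"
      using x \<open>y \<in> M\<close> commute[of x y] by simp
    ultimately show ?thesis
      using x(1) r(2) unfolding \<B>_def by blast
  qed
  moreover have "countable \<B>" "\<forall>V\<in>\<B>. openin mtopology V"
    using D(1) by (auto simp: \<B>_def)
  ultimately show ?thesis
    unfolding second_countable_def X by blast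
qed

text \<open>
  This is Lusin's argument for the separation of disjoint analytic sets. If the images were not
  separated, then, a countable cover of \<open>Z\<close> by small balls being available at every stage, there would
  be shrinking closed sets \<open>A\<^sub>n \<subseteq> A\<close> and \<open>B\<^sub>n \<subseteq> B\<close> of vanishing diameter whose images are never
  separated. By completeness they shrink to points \<open>a \<in> A\<close> and \<open>b \<in> B\<close>. But \<open>p a \<noteq> p b\<close> have disjoint
  open neighbourhoods, and these contain the images of \<open>A\<^sub>n\<close> and \<open>B\<^sub>n\<close> for large \<open>n\<close>.
\<close>

lemma category_separated_images:
  assumes Z: "completely_metrizable_space Z" "separable_space Z"
    and X: "Hausdorff_space X" and p: "continuous_map Z X p"
    and AB: "closedin Z A" "closedin Z B" "p ` A \<inter> p ` B = {}"
  shows "category_separated X (p ` A) (p ` B)"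
proof (rule ccontr)
  assume "\<not> ?thesis"
  obtain M d where "Metric_space M d" and complete: "Metric_space.mcomplete M d"
    and Zeq: "Z = Metric_space.mtopology M d"
    using Z(1) by (auto simp: completely_metrizable_space_def)
  then interpret Metric_space M d by simp
  obtain D where D: "countable D" "D \<subseteq> M" "mtopology closure_of D = M"
    using Z(2) by (auto simp: separable_space_def Zeq)
  \<comment> \<open>Countable unions preserve separation, so a non-separated pair contains a narrow one.\<close>
  define bad where "bad = (\<lambda>(A', B'). closedin Z A' \<and> closedin Z B' \<and>
      \<not> category_separated X (p ` A') (p ` B'))"
  define narrow where "narrow = (\<lambda>n E. \<exists>x. E \<subseteq> mcball x (inverse (real (Suc n))))"
  have pim: "p ` C \<subseteq> topspace X" if "closedin Z C" for C
    using continuous_map_image_subset_topspace[OF p] closedin_subset[OF that] by blast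
  have step: "\<exists>A2 B2. bad (A2, B2) \<and> A2 \<subseteq> A1 \<and> B2 \<subseteq> B1 \<and> narrow n A2 \<and> narrow n B2"
    if "bad (A1, B1)" for A1 B1 n
  proof (rule ccontr)
    assume contr: "\<not> ?thesis"
    let ?r = "inverse (real (Suc n))"
    have cl: "closedin Z A1" "closedin Z B1"
      and nonsep: "\<not> category_separated X (p ` A1) (p ` B1)"
      using that by (simp_all add: bad_def)
    have clx: "closedin Z (A1 \<inter> mcball x ?r)" "closedin Z (B1 \<inter> mcball x ?r)" for x
      using cl closedin_mcball by (simp_all add: Zeq closedin_Int)
    have "narrow n (A1 \<inter> mcball x ?r)" "narrow n (B1 \<inter> mcball y ?r)" for x y
      by (auto simp: narrow_def)
    then have "\<not> bad (A1 \<inter> mcball x ?r, B1 \<inter> mcball y ?r)" for x y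
      using contr inf_le1 by metis
    then have "category_separated X (p ` (A1 \<inter> mcball x ?r)) (p ` (B1 \<inter> mcball y ?r))" for x y
      using clx unfolding bad_def by blast
    then have "category_separated X (\<Union>x\<in>D. p ` (A1 \<inter> mcball x ?r)) (\<Union>y\<in>D. p ` (B1 \<inter> mcball y ?r))"
      using D(1) pim[OF clx(1)] pim[OF clx(2)] by (intro category_separated_UN)
    moreover have "M \<subseteq> (\<Union>x\<in>D. mcball x ?r)"
      by (rule countable_cover_mcball[OF D(1,3)]) simp
    then have "(\<Union>x\<in>D. C \<inter> mcball x ?r) = C" if "closedin Z C" for C
      using closedin_subset[OF that] by (auto simp: Zeq)
    then have "(\<Union>x\<in>D. p ` (A1 \<inter> mcball x ?r)) = p ` A1" "(\<Union>x\<in>D. p ` (B1 \<inter> mcball x ?r)) = p ` B1"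
      using cl by (metis image_UN)+
    ultimately show False
      using nonsep by simp
  qed
  have "bad (A, B)"
    using AB \<open>\<not> category_separated X (p ` A) (p ` B)\<close> by (simp add: bad_def)
  obtain E where E0: "E 0 = (A, B)" and bad: "\<And>n. bad (E n)"
    and E: "\<And>n. fst (E (Suc n)) \<subseteq> fst (E n) \<and> snd (E (Suc n)) \<subseteq> snd (E n) \<and>
                 narrow n (fst (E (Suc n))) \<and> narrow n (snd (E (Suc n)))"
  proof -
    have "\<exists>E. \<forall>n. (bad (E n) \<and> (n = 0 \<longrightarrow> E n = (A, B))) \<and>
        (fst (E (Suc n)) \<subseteq> fst (E n) \<and> snd (E (Suc n)) \<subseteq> snd (E n) \<and>
         narrow n (fst (E (Suc n))) \<and> narrow n (snd (E (Suc n))))"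
    proof (rule dependent_nat_choice)
      show "\<exists>x. bad x \<and> (0 = 0 \<longrightarrow> x = (A, B))"
        using \<open>bad (A, B)\<close> by blast
      show "\<exists>y. (bad y \<and> (Suc n = 0 \<longrightarrow> y = (A, B))) \<and> fst y \<subseteq> fst x \<and> snd y \<subseteq> snd x \<and>
            narrow n (fst y) \<and> narrow n (snd y)" if "bad x \<and> (n = 0 \<longrightarrow> x = (A, B))" for x n
        using step[of "fst x" "snd x" n] that by auto
    qed
    then show thesis
      using that by metis
  qed
  have cl: "closedin mtopology (fst (E n))" "closedin mtopology (snd (E n))" for n
    using bad[of n] by (auto simp: bad_def Zeq split: prod.splits)
  have ne: "fst (E n) \<noteq> {}" "snd (E n) \<noteq> {}" for n
  proof -
    have "category_separated X {} C" "category_separated X C {}" if "C \<subseteq> topspace X" for C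
      using that meagre_in_empty unfolding category_separated_def by blast+
    then show "fst (E n) \<noteq> {}" "snd (E n) \<noteq> {}"
      using bad[of n] pim by (force simp: bad_def split: prod.splits)+
  qed
  have dec: "decseq (\<lambda>n. fst (E n))" "decseq (\<lambda>n. snd (E n))"
    using E by (auto intro: decseq_SucI)
  have small: "\<exists>n x. C n \<subseteq> mcball x \<epsilon>" if \<epsilon>: "\<epsilon> > 0" and narrow: "\<And>n. narrow n (C (Suc n))" for C \<epsilon>
  proof -
    obtain n where "inverse (real (Suc n)) < \<epsilon>"
      using \<epsilon> reals_Archimedean by blast
    moreover obtain x where "C (Suc n) \<subseteq> mcball x (inverse (real (Suc n)))"
      using narrow[of n] by (auto simp: narrow_def)
    ultimately show ?thesis
      by (meson less_imp_le mcball_subset_concentric order_trans)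
  qed
  have nest: "\<exists>c. \<forall>n. c \<in> C n"
    if C: "\<And>n. closedin mtopology (C n)" "\<And>n. C n \<noteq> {}" "decseq C"
      "\<And>n. narrow n (C (Suc n))" for C
  proof -
    have "\<Inter>(range C) \<noteq> {}"
      using complete C(1-3) small[OF _ C(4)] unfolding mcomplete_nest by blast
    then show ?thesis
      by blast
  qed
  obtain a where a: "\<And>n. a \<in> fst (E n)"
    using nest[OF cl(1) ne(1) dec(1)] E by blast
  obtain b where b: "\<And>n. b \<in> snd (E n)"
    using nest[OF cl(2) ne(2) dec(2)] E by blast
  have "a \<in> A" "b \<in> B"
    using a[of 0] b[of 0] E0 by auto
  then have "p a \<noteq> p b" "p a \<in> topspace X" "p b \<in> topspace X"
    using AB pim by blast+
  then obtain U V where U: "openin X U" "p a \<in> U" and V: "openin X V" "p b \<in> V" and "disjnt U V"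
    using X unfolding Hausdorff_space_def by metis
  have near: "\<exists>N. \<forall>n\<ge>N. p ` C n \<subseteq> W"
    if W: "openin X W" "p c \<in> W" and C: "\<And>n. c \<in> C n" "decseq C" "\<And>n. narrow n (C (Suc n))"
      "\<And>n. closedin mtopology (C n)" for W c C
  proof -
    have "openin mtopology {z \<in> M. p z \<in> W}"
      using openin_continuous_map_preimage[OF p W(1)] by (simp add: Zeq)
    moreover have "c \<in> M"
      using C(1) closedin_subset[OF C(4)] by auto
    ultimately obtain r where r: "r > 0" "mball c r \<subseteq> {z \<in> M. p z \<in> W}"
      using W(2) unfolding openin_mtopology by blast
    obtain n x where nx: "C n \<subseteq> mcball x (r / 3)"
      using small[of "r / 3" C] r(1) C(3) by auto
    have "C n \<subseteq> mball c r"
    proof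
      fix z assume "z \<in> C n"
      with nx C(1)[of n] have "c \<in> mcball x (r/3)" "z \<in> mcball x (r/3)" by auto
      then show "z \<in> mball c r"
        using triangle[of c x z] commute[of x c] r by simp
    qed
    then have "p ` C m \<subseteq> W" if "m \<ge> n" for m
      using r(2) decseqD[OF C(2) that] by auto
    then show ?thesis by blast
  qed
  obtain N where N: "\<And>n. n \<ge> N \<Longrightarrow> p ` fst (E n) \<subseteq> U"
    using near[OF U, of "\<lambda>n. fst (E n)"] a dec(1) E cl(1) by blast
  obtain N' where N': "\<And>n. n \<ge> N' \<Longrightarrow> p ` snd (E n) \<subseteq> V"
    using near[OF V, of "\<lambda>n. snd (E n)"] b dec(2) E cl(2) by blast
  have "category_separated X (p ` fst (E (max N N'))) (p ` snd (E (max N N')))"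
    unfolding category_separated_def
    using N[of "max N N'"] N'[of "max N N'"] U \<open>disjnt U V\<close> meagre_in_empty
    by (intro exI[of _ U] exI[of _ "{}"]) (auto simp: disjnt_def)
  then show False
    using bad[of "max N N'"] by (auto simp: bad_def split: prod.splits)
qed

text \<open>
  The preimage of \<open>W\<close> under \<open>f\<close> and its complement are projections of parts of the graph. The part over
  the complement of an open \<open>W\<close> is closed and the part over \<open>W\<close> is a countable union of closed sets, so
  the two projections are separated: off a meagre set, the preimage of \<open>W\<close> agrees with an open set.
  Collecting the exceptional sets of a countable base gives the claim.
\<close>

lemma closed_graph_continuous_off_meagre:
  assumes X: "completely_metrizable_space X" "separable_space X"
    and Y: "completely_metrizable_space Y" "separable_space Y"
    and f: "f \<in> topspace X \<rightarrow> topspace Y"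
    and graph: "closedin (prod_topology X Y) ((\<lambda>x. (x, f x)) ` topspace X)"
  shows "\<exists>M\<subseteq>topspace X. meagre_in X M \<and> continuous_map (subtopology X (topspace X - M)) Y f"
proof -
  let ?gr = "(\<lambda>x. (x, f x)) ` topspace X"
  have sep: "category_separated X {x \<in> topspace X. f x \<in> W} {x \<in> topspace X. f x \<notin> W}"
    if W: "openin Y W" for W
  proof -
    obtain C :: "nat \<Rightarrow> 'b set" where C: "\<And>n. closedin Y (C n)" "\<Union>(range C) = W"
      using open_imp_fsigma_in[OF completely_metrizable_imp_metrizable_space[OF Y(1)] W]
      unfolding fsigma_in_ascending by blast
    have "category_separated X {x \<in> topspace X. f x \<in> C n} {x \<in> topspace X. f x \<notin> W}" for n
    proof -
      let ?A = "?gr \<inter> topspace X \<times> C n" and ?B = "?gr \<inter> topspace X \<times> (topspace Y - W)"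
      have "category_separated X (fst ` ?A) (fst ` ?B)"
      proof (rule category_separated_images)
        show "completely_metrizable_space (prod_topology X Y)" "separable_space (prod_topology X Y)"
          using X Y by (simp_all add: completely_metrizable_space_prod_topology
              separable_space_prod_topology)
        show "Hausdorff_space X"
          using X(1) by (simp add: completely_metrizable_imp_metrizable_space
              metrizable_imp_Hausdorff_space)
        show "continuous_map (prod_topology X Y) X fst"
          by (rule continuous_map_fst)
        show "closedin (prod_topology X Y) ?A" "closedin (prod_topology X Y) ?B"
          using graph C(1) W by (simp_all add: closedin_Int closedin_prod_Times_iff closedin_diff)
        show "fst ` ?A \<inter> fst ` ?B = {}"
          using C(2) by auto
      qed
      moreover have "fst ` ?A = {x \<in> topspace X. f x \<in> C n}"
        by force
      moreover have "fst ` ?B = {x \<in> topspace X. f x \<notin> W}"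
        using f by (force simp: Pi_iff)
      ultimately show ?thesis
        by simp
    qed
    then have "category_separated X (\<Union>n. {x \<in> topspace X. f x \<in> C n}) {x \<in> topspace X. f x \<notin> W}"
      by (intro category_separated_UN_left) auto
    moreover have "(\<Union>n. {x \<in> topspace X. f x \<in> C n}) = {x \<in> topspace X. f x \<in> W}"
      using C(2) by auto
    ultimately show ?thesis
      by simp
  qed
  have "\<exists>U M. openin Y W \<longrightarrow> openin X U \<and> meagre_in X M \<and>
      (\<forall>x\<in>topspace X - M. f x \<in> W \<longleftrightarrow> x \<in> U)" for W
  proof (cases "openin Y W")
    case True
    then obtain U M where "openin X U" "meagre_in X M" "{x \<in> topspace X. f x \<in> W} \<subseteq> U \<union> M"
      "{x \<in> topspace X. f x \<notin> W} \<inter> U \<subseteq> M"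
      using sep unfolding category_separated_def by blast
    then show ?thesis
      by (intro exI[of _ U] exI[of _ M]) auto
  qed simp
  then obtain U M where UM: "\<And>W. openin Y W \<Longrightarrow> openin X (U W) \<and> meagre_in X (M W) \<and>
      (\<forall>x\<in>topspace X - M W. f x \<in> W \<longleftrightarrow> x \<in> U W)"
    by metis
  have "second_countable Y"
    using Y by (simp add: completely_metrizable_imp_metrizable_space
        separable_metrizable_imp_second_countable)
  then obtain \<B> where \<B>: "countable \<B>" "\<And>V. V \<in> \<B> \<Longrightarrow> openin Y V"
    "\<And>W y. openin Y W \<Longrightarrow> y \<in> W \<Longrightarrow> \<exists>V\<in>\<B>. y \<in> V \<and> V \<subseteq> W"
    unfolding second_countable_def by metis
  define N where "N = topspace X \<inter> (\<Union>V\<in>\<B>. M V)"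
  have "meagre_in X N"
  proof (rule meagre_in_subset)
    show "meagre_in X (\<Union>V\<in>\<B>. M V)"
      using \<B>(1,2) UM by (intro meagre_in_UN) auto
  qed (simp add: N_def)
  moreover have "continuous_map (subtopology X (topspace X - N)) Y f"
    unfolding continuous_map_def
  proof (intro conjI allI impI)
    show "f \<in> topspace (subtopology X (topspace X - N)) \<rightarrow> topspace Y"
      using f by auto
    fix W assume W: "openin Y W"
    have "x \<in> (\<Union>V\<in>{V\<in>\<B>. V \<subseteq> W}. U V) \<longleftrightarrow> f x \<in> W" if x: "x \<in> topspace X - N" for x
    proof -
      have "x \<in> U V \<longleftrightarrow> f x \<in> V" if "V \<in> \<B>" for V
        using x UM[OF \<B>(2)[OF that]] that by (auto simp: N_def)
      then show ?thesis
        using \<B>(3)[OF W, of "f x"] by blast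
    qed
    then have "{x \<in> topspace (subtopology X (topspace X - N)). f x \<in> W} =
        (\<Union>V\<in>{V\<in>\<B>. V \<subseteq> W}. U V) \<inter> (topspace X - N)"
      by auto
    moreover have "openin X (\<Union>V\<in>{V\<in>\<B>. V \<subseteq> W}. U V)"
      using UM \<B>(2) by auto
    ultimately show "openin (subtopology X (topspace X - N))
        {x \<in> topspace (subtopology X (topspace X - N)). f x \<in> W}"
      by (auto simp: openin_subtopology)
  qed
  ultimately show ?thesis
    by (intro exI[of _ N]) (auto simp: N_def)
qed

text \<open>
  By injectivity of \<open>\<phi>\<close> the graph is given by the closed condition \<open>\<phi> (f x) = \<phi> y\<close>. Below, \<open>\<phi>\<close> is
  essentially the compression \<open>\<psi>\<close>, and \<open>f\<close> a map that is defined through the inverse of \<open>\<phi>\<close>, which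
  need not be continuous.
\<close>

lemma closed_graph_if_injection_comp_continuous:
  assumes Z: "Hausdorff_space Z" and \<phi>: "continuous_map Y Z \<phi>" "inj_on \<phi> (topspace Y)"
    and f: "f \<in> topspace X \<rightarrow> topspace Y" and comp: "continuous_map X Z (\<lambda>x. \<phi> (f x))"
  shows "closedin (prod_topology X Y) ((\<lambda>x. (x, f x)) ` topspace X)"
proof -
  have "closedin (prod_topology X Y) {p \<in> topspace (prod_topology X Y). \<phi> (f (fst p)) = \<phi> (snd p)}"
    using continuous_map_compose[OF continuous_map_fst comp]
      continuous_map_compose[OF continuous_map_snd \<phi>(1)]
    by (intro closedin_continuous_maps_eq[OF Z]) (simp_all add: o_def)
  moreover have "{p \<in> topspace (prod_topology X Y). \<phi> (f (fst p)) = \<phi> (snd p)} =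
      (\<lambda>x. (x, f x)) ` topspace X"
    using f \<phi>(2) by (auto simp: inj_on_def Pi_iff image_iff)
  ultimately show ?thesis
    by simp
qed

section \<open>Automatic continuity of equivariant maps\<close>

lemma continuous_map_sequentially:
  assumes X: "metrizable_space X" and f: "f \<in> topspace X \<rightarrow> topspace Y"
    and lim: "\<And>\<sigma> l. range \<sigma> \<subseteq> topspace X \<Longrightarrow> limitin X \<sigma> l sequentially \<Longrightarrow>
               limitin Y (f \<circ> \<sigma>) (f l) sequentially"
  shows "continuous_map X Y f"
  unfolding continuous_map_closedin
proof (intro conjI ballI allI impI)
  obtain M d where "Metric_space M d" and Xeq: "X = Metric_space.mtopology M d"
    using X by (auto simp: metrizable_space_def)
  then interpret Metric_space M d by simp
  show "f \<in> topspace X \<rightarrow> topspace Y"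
    by (rule f)
  fix C assume C: "closedin Y C"
  show "closedin X {x \<in> topspace X. f x \<in> C}"
    unfolding Xeq metric_closedin_iff_sequentially_closed
  proof (intro conjI allI impI)
    show "{x \<in> topspace mtopology. f x \<in> C} \<subseteq> M"
      by auto
    fix \<sigma> l assume \<sigma>: "range \<sigma> \<subseteq> {x \<in> topspace mtopology. f x \<in> C} \<and> limitin mtopology \<sigma> l sequentially"
    then have "limitin Y (f \<circ> \<sigma>) (f l) sequentially"
      using lim[of \<sigma> l] by (auto simp: Xeq)
    then have "f l \<in> C"
    proof (rule limitin_closedin[OF _ C])
      show "\<forall>\<^sub>F n in sequentially. (f \<circ> \<sigma>) n \<in> C"
        using \<sigma> by (intro always_eventually) (auto simp: image_subset_iff)
    qed simp
    then show "l \<in> {x \<in> topspace mtopology. f x \<in> C}"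
      using \<sigma> limitin_mspace by auto
  qed
qed

text \<open>
  Given \<open>x\<^sub>n \<longlonglongrightarrow> x\<close> and a meagre set \<open>M\<close> off which \<open>f\<close> is continuous, the elements \<open>k\<close> for which some
  \<open>k x\<^sub>n\<close> or \<open>k x\<close> lies in \<open>M\<close> form a countable union of right translates of \<open>M\<close>, so some \<open>k\<close> avoids them
  all. Then \<open>f (k x\<^sub>n) \<longlonglongrightarrow> f (k x)\<close>, and the map \<open>\<tau>\<close> that undoes \<open>k\<close> gives \<open>f x\<^sub>n \<longlonglongrightarrow> f x\<close>.
  The domain is a group with separately continuous multiplication rather than a topological group
  because joint continuity in the semidirect product is what the lemma serves to establish.
\<close>

lemma equivariant_closed_graph_imp_continuous:
  fixes G (structure)
  assumes "group G" and carrier: "topspace X = carrier G"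
    and X: "completely_metrizable_space X" "separable_space X"
    and left: "\<And>a. a \<in> carrier G \<Longrightarrow> continuous_map X X (\<lambda>x. a \<otimes> x)"
    and right: "\<And>a. a \<in> carrier G \<Longrightarrow> continuous_map X X (\<lambda>x. x \<otimes> a)"
    and Y: "completely_metrizable_space Y" "separable_space Y"
    and f: "f \<in> topspace X \<rightarrow> topspace Y"
    and graph: "closedin (prod_topology X Y) ((\<lambda>x. (x, f x)) ` topspace X)"
    and equivariant: "\<And>a. a \<in> carrier G \<Longrightarrow>
           \<exists>\<tau>. continuous_map Y Y \<tau> \<and> (\<forall>x\<in>carrier G. \<tau> (f (a \<otimes> x)) = f x)"
  shows "continuous_map X Y f"
proof (rule continuous_map_sequentially[OF _ f])
  interpret group G by fact
  show "metrizable_space X"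
    using X(1) by (rule completely_metrizable_imp_metrizable_space)
  obtain M where M: "M \<subseteq> carrier G" "meagre_in X M"
    and cont: "continuous_map (subtopology X (topspace X - M)) Y f"
    using closed_graph_continuous_off_meagre[OF X Y f graph] carrier by auto
  fix \<sigma> :: "nat \<Rightarrow> 'a" and l
  assume \<sigma>: "range \<sigma> \<subseteq> topspace X" and lim: "limitin X \<sigma> l sequentially"
  define A where "A = insert l (range \<sigma>)"
  have A: "A \<subseteq> carrier G" "countable A"
    using \<sigma> limitin_topspace[OF lim] by (auto simp: A_def carrier)
  have "meagre_in X ((\<lambda>x. x \<otimes> inv a) ` M)" if "a \<in> carrier G" for a
  proof -
    have "homeomorphic_maps X X (\<lambda>x. x \<otimes> inv a) (\<lambda>x. x \<otimes> a)"
      using that right by (simp add: homeomorphic_maps_def carrier m_assoc)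
    then have "homeomorphic_map X X (\<lambda>x. x \<otimes> inv a)"
      by (rule homeomorphic_maps_imp_map)
    then show ?thesis
      using M by (intro meagre_in_homeomorphic_image[of X X]) (simp_all add: carrier)
  qed
  then have "meagre_in X (\<Union>a\<in>A. (\<lambda>x. x \<otimes> inv a) ` M)"
    using A by (intro meagre_in_UN) auto
  then obtain k where k: "k \<in> carrier G" "k \<notin> (\<Union>a\<in>A. (\<lambda>x. x \<otimes> inv a) ` M)"
    using completely_metrizable_not_meagre[OF X(1)] carrier one_closed by blast
  have good: "k \<otimes> a \<in> topspace X - M" if "a \<in> A" for a
  proof -
    have "a \<in> carrier G" "k = (k \<otimes> a) \<otimes> inv a"
      using A(1) that k(1) by (auto simp: m_assoc)
    then show ?thesis
      using k that carrier by auto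
  qed
  have "limitin X ((\<lambda>x. k \<otimes> x) \<circ> \<sigma>) (k \<otimes> l) sequentially"
    by (rule continuous_map_limit[OF left[OF k(1)] lim])
  then have "limitin (subtopology X (topspace X - M)) ((\<lambda>x. k \<otimes> x) \<circ> \<sigma>) (k \<otimes> l) sequentially"
    using good unfolding limitin_subtopology by (auto simp: A_def)
  then have "limitin Y (f \<circ> ((\<lambda>x. k \<otimes> x) \<circ> \<sigma>)) (f (k \<otimes> l)) sequentially"
    by (rule continuous_map_limit[OF cont])
  moreover obtain \<tau> where \<tau>: "continuous_map Y Y \<tau>" "\<And>x. x \<in> carrier G \<Longrightarrow> \<tau> (f (k \<otimes> x)) = f x"
    using equivariant[OF k(1)] by blast
  ultimately have "limitin Y (\<tau> \<circ> (f \<circ> ((\<lambda>x. k \<otimes> x) \<circ> \<sigma>))) (\<tau> (f (k \<otimes> l))) sequentially"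
    using continuous_map_limit[OF \<tau>(1)] by blast
  moreover have "\<tau> (f (k \<otimes> a)) = f a" if "a \<in> A" for a
    using \<tau>(2) A(1) that by blast
  then have "\<tau> \<circ> (f \<circ> ((\<lambda>x. k \<otimes> x) \<circ> \<sigma>)) = f \<circ> \<sigma>" "\<tau> (f (k \<otimes> l)) = f l"
    by (auto simp: A_def)
  ultimately show "limitin Y (f \<circ> \<sigma>) (f l) sequentially"
    by simp
qed

lemma topological_group_continuous_mult:
  assumes "topological_group G S" "continuous_map X S f" "continuous_map X S g"
  shows "continuous_map X S (\<lambda>x. f x \<otimes>\<^bsub>G\<^esub> g x)"
proof -
  have "continuous_map X (prod_topology S S) (\<lambda>x. (f x, g x))"
    using assms by (simp add: continuous_map_paired)
  moreover have "continuous_map (prod_topology S S) S (\<lambda>(x, y). x \<otimes>\<^bsub>G\<^esub> y)"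
    using assms(1) by (simp add: topological_group_def)
  ultimately show ?thesis
    using continuous_map_compose by (fastforce simp: o_def)
qed

lemma topological_group_continuous_inv:
  assumes "topological_group G S" "continuous_map X S f"
  shows "continuous_map X S (\<lambda>x. inv\<^bsub>G\<^esub> f x)"
  using assms continuous_map_compose[of X S f S "\<lambda>x. inv\<^bsub>G\<^esub> x"]
  by (simp add: topological_group_def o_def)

section \<open>The semidirect product of a normal compression\<close>

locale polish_compression =
  fixes G :: "('a, 'm) monoid_scheme" and S :: "'a topology"
    and H :: "('b, 'n) monoid_scheme" and T :: "'b topology"
    and \<psi> :: "'a \<Rightarrow> 'b"
  assumes polish_G: "polish_group G S" and polish_H: "polish_group H T"
    and compression: "normal_compression G S H T \<psi>"
begin

sublocale G: group G
  using polish_G by (simp add: polish_group_def topological_group_def)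

sublocale H: group H
  using polish_H by (simp add: polish_group_def topological_group_def)

sublocale \<psi>: group_hom G H \<psi>
  using compression
  by (simp add: group_hom_def group_hom_axioms_def normal_compression_def G.group_axioms H.group_axioms)

lemma topspace_S: "topspace S = carrier G" and topspace_T: "topspace T = carrier H"
  using polish_G polish_H by (simp_all add: polish_group_def topological_group_def)

lemma inj: "x \<in> carrier G \<Longrightarrow> y \<in> carrier G \<Longrightarrow> \<psi> x = \<psi> y \<longleftrightarrow> x = y"
  using compression by (auto simp: normal_compression_def inj_on_def)

lemma continuous_\<psi>: "continuous_map S T \<psi>"
  using compression by (simp add: normal_compression_def)

lemma Hausdorff_T: "Hausdorff_space T"
  using polish_H
  by (simp_all add: polish_group_def completely_metrizable_imp_metrizable_space metrizable_imp_Hausdorff_space)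

abbreviation act where "act \<equiv> equivariant_action G H \<psi>"

abbreviation P where "P \<equiv> semidirect G H \<psi>"

abbreviation R where "R \<equiv> prod_topology S T"

lemmas act_closed [simp] = equivariant_action(1)[OF compression]
  and \<psi>_act [simp] = equivariant_action(2)[OF compression]

text \<open>
  Identities for the action are checked after applying \<open>\<psi>\<close>, where they are identities between
  conjugates in \<open>H\<close>.
\<close>

lemma act_eqI:
  assumes "g \<in> carrier G" "h \<in> carrier H" "x \<in> carrier G" "\<psi> x = h \<otimes>\<^bsub>H\<^esub> \<psi> g \<otimes>\<^bsub>H\<^esub> inv\<^bsub>H\<^esub> h"
  shows "act h g = x"
  using assms by (simp flip: inj)

lemma H_cancel [simp]:
  assumes "a \<in> carrier H" "b \<in> carrier H"
  shows "inv\<^bsub>H\<^esub> a \<otimes>\<^bsub>H\<^esub> (a \<otimes>\<^bsub>H\<^esub> b) = b" "a \<otimes>\<^bsub>H\<^esub> (inv\<^bsub>H\<^esub> a \<otimes>\<^bsub>H\<^esub> b) = b"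
  using assms by (simp_all flip: H.m_assoc)

lemma act_mult:
  assumes "a \<in> carrier G" "b \<in> carrier G" "h \<in> carrier H"
  shows "act h (a \<otimes>\<^bsub>G\<^esub> b) = act h a \<otimes>\<^bsub>G\<^esub> act h b"
  using assms by (intro act_eqI) (simp_all add: H.m_assoc)

lemma act_one: "g \<in> carrier G \<Longrightarrow> act \<one>\<^bsub>H\<^esub> g = g"
  by (rule act_eqI) simp_all

lemma act_act:
  assumes "g \<in> carrier G" "h \<in> carrier H" "k \<in> carrier H"
  shows "act h (act k g) = act (h \<otimes>\<^bsub>H\<^esub> k) g"
  using assms by (intro act_eqI) (simp_all add: H.m_assoc H.inv_mult_group)

lemma act_\<psi>:
  assumes "a \<in> carrier G" "b \<in> carrier G"
  shows "act (\<psi> a) b = a \<otimes>\<^bsub>G\<^esub> b \<otimes>\<^bsub>G\<^esub> inv\<^bsub>G\<^esub> a"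
  using assms by (intro act_eqI) simp_all

lemma carrier_P: "carrier P = carrier G \<times> carrier H"
  and mult_P: "x \<otimes>\<^bsub>P\<^esub> y = (fst x \<otimes>\<^bsub>G\<^esub> act (snd x) (fst y), snd x \<otimes>\<^bsub>H\<^esub> snd y)"
  and one_P: "\<one>\<^bsub>P\<^esub> = (\<one>\<^bsub>G\<^esub>, \<one>\<^bsub>H\<^esub>)"
  by (simp_all add: semidirect_def case_prod_beta)

lemma topspace_R: "topspace R = carrier P"
  by (simp add: topspace_S topspace_T carrier_P)

lemma group_P: "group P"
proof (rule groupI)
  show "x \<otimes>\<^bsub>P\<^esub> y \<otimes>\<^bsub>P\<^esub> z = x \<otimes>\<^bsub>P\<^esub> (y \<otimes>\<^bsub>P\<^esub> z)"
    if "x \<in> carrier P" "y \<in> carrier P" "z \<in> carrier P" for x y z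
    using that by (auto simp: carrier_P mult_P act_mult act_act G.m_assoc H.m_assoc)
  show "\<exists>y\<in>carrier P. y \<otimes>\<^bsub>P\<^esub> x = \<one>\<^bsub>P\<^esub>" if "x \<in> carrier P" for x
    using that
    by (intro bexI[of _ "(act (inv\<^bsub>H\<^esub> (snd x)) (inv\<^bsub>G\<^esub> (fst x)), inv\<^bsub>H\<^esub> (snd x))"])
      (auto simp: carrier_P mult_P one_P simp flip: act_mult inj)
qed (auto simp: carrier_P mult_P one_P act_one)

sublocale P: group P
  by (rule group_P)

lemma inv_P:
  assumes "x \<in> carrier P"
  shows "inv\<^bsub>P\<^esub> x = (act (inv\<^bsub>H\<^esub> (snd x)) (inv\<^bsub>G\<^esub> (fst x)), inv\<^bsub>H\<^esub> (snd x))"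
  using assms
  by (intro P.inv_equality) (auto simp: carrier_P mult_P one_P simp flip: act_mult inj)

lemma continuous_mult_G:
    "continuous_map X S f \<Longrightarrow> continuous_map X S f' \<Longrightarrow> continuous_map X S (\<lambda>x. f x \<otimes>\<^bsub>G\<^esub> f' x)"
  and continuous_inv_G: "continuous_map X S f \<Longrightarrow> continuous_map X S (\<lambda>x. inv\<^bsub>G\<^esub> f x)"
  and continuous_mult_H:
    "continuous_map X T k \<Longrightarrow> continuous_map X T k' \<Longrightarrow> continuous_map X T (\<lambda>x. k x \<otimes>\<^bsub>H\<^esub> k' x)"
  and continuous_inv_H: "continuous_map X T k \<Longrightarrow> continuous_map X T (\<lambda>x. inv\<^bsub>H\<^esub> k x)"
  using polish_G polish_H unfolding polish_group_def
  by (blast intro: topological_group_continuous_mult topological_group_continuous_inv)+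

lemma continuous_const_G: "g \<in> carrier G \<Longrightarrow> continuous_map X S (\<lambda>x. g)"
  and continuous_const_H: "h \<in> carrier H \<Longrightarrow> continuous_map X T (\<lambda>x. h)"
  by (simp_all add: topspace_S topspace_T)

lemma continuous_comp_\<psi>: "continuous_map X S f \<Longrightarrow> continuous_map X T (\<lambda>x. \<psi> (f x))"
  using continuous_map_compose[OF _ continuous_\<psi>] by (simp add: o_def)

lemmas continuous_rules = continuous_mult_G continuous_inv_G continuous_mult_H continuous_inv_H
  continuous_const_G continuous_const_H continuous_comp_\<psi> continuous_map_id[unfolded id_def]

text \<open>
  Here equivariance is \<open>h.x = (h.a)\<inverse> (h.(a x))\<close>, as each \<open>h\<close> acts by an automorphism.
\<close>

lemma continuous_act:
  assumes h: "h \<in> carrier H"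
  shows "continuous_map S S (act h)"
proof (rule equivariant_closed_graph_imp_continuous[OF G.group_axioms topspace_S])
  show "completely_metrizable_space S" "separable_space S"
    "completely_metrizable_space S" "separable_space S"
    using polish_G by (simp_all add: polish_group_def)
  show "act h \<in> topspace S \<rightarrow> topspace S"
    using h by (auto simp: topspace_S)
  have "continuous_map S T (\<lambda>g. h \<otimes>\<^bsub>H\<^esub> \<psi> g \<otimes>\<^bsub>H\<^esub> inv\<^bsub>H\<^esub> h)"
    using h by (intro continuous_rules) simp_all
  then have "continuous_map S T (\<lambda>g. \<psi> (act h g))"
    by (rule continuous_map_eq) (use h in \<open>simp add: topspace_S\<close>)
  then show "closedin (prod_topology S S) ((\<lambda>g. (g, act h g)) ` topspace S)"
    using h
    by (intro closed_graph_if_injection_comp_continuous[OF Hausdorff_T continuous_\<psi>])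
      (auto simp: inj_on_def inj topspace_S)
  show "\<exists>\<tau>. continuous_map S S \<tau> \<and> (\<forall>x\<in>carrier G. \<tau> (act h (a \<otimes>\<^bsub>G\<^esub> x)) = act h x)"
    if a: "a \<in> carrier G" for a
  proof (intro exI conjI ballI)
    show "continuous_map S S (\<lambda>y. inv\<^bsub>G\<^esub> (act h a) \<otimes>\<^bsub>G\<^esub> y)"
      using a h by (intro continuous_rules) simp_all
    show "inv\<^bsub>G\<^esub> (act h a) \<otimes>\<^bsub>G\<^esub> act h (a \<otimes>\<^bsub>G\<^esub> x) = act h x" if "x \<in> carrier G" for x
      using a h that by (simp add: act_mult flip: G.m_assoc)
  qed
qed (intro continuous_rules; simp)+

text \<open>
  Here equivariance is \<open>x.g = a\<inverse>.((a x).g)\<close>; the undoing map \<open>y \<mapsto> a\<inverse>.y\<close> is continuous because each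
  single element of \<open>H\<close> is already known to act continuously.
\<close>

lemma continuous_orbit_map:
  assumes g: "g \<in> carrier G"
  shows "continuous_map T S (\<lambda>h. act h g)"
proof (rule equivariant_closed_graph_imp_continuous[OF H.group_axioms topspace_T])
  show "completely_metrizable_space S" "separable_space S"
    "completely_metrizable_space T" "separable_space T"
    using polish_G polish_H by (simp_all add: polish_group_def)
  show "(\<lambda>h. act h g) \<in> topspace T \<rightarrow> topspace S"
    using g by (auto simp: topspace_S topspace_T)
  have "continuous_map T T (\<lambda>h. h \<otimes>\<^bsub>H\<^esub> \<psi> g \<otimes>\<^bsub>H\<^esub> inv\<^bsub>H\<^esub> h)"
    using g by (intro continuous_rules) simp_all
  then have "continuous_map T T (\<lambda>h. \<psi> (act h g))"
    by (rule continuous_map_eq) (use g in \<open>simp add: topspace_T\<close>)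
  then show "closedin (prod_topology T S) ((\<lambda>h. (h, act h g)) ` topspace T)"
    using g
    by (intro closed_graph_if_injection_comp_continuous[OF Hausdorff_T continuous_\<psi>])
      (auto simp: inj_on_def inj topspace_S topspace_T)
  show "\<exists>\<tau>. continuous_map S S \<tau> \<and> (\<forall>x\<in>carrier H. \<tau> (act (a \<otimes>\<^bsub>H\<^esub> x) g) = act x g)"
    if a: "a \<in> carrier H" for a
    using a g by (intro exI[of _ "act (inv\<^bsub>H\<^esub> a)"]) (simp add: continuous_act act_act)
qed (intro continuous_rules; simp)+

lemma continuous_R_iff:
  "continuous_map X R f \<longleftrightarrow> continuous_map X S (\<lambda>x. fst (f x)) \<and> continuous_map X T (\<lambda>x. snd (f x))"
  by (simp add: continuous_map_pairwise o_def)

lemma continuous_comp_fst_R: "continuous_map X R f \<Longrightarrow> continuous_map X S (\<lambda>x. fst (f x))"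
  and continuous_comp_snd_R: "continuous_map X R f \<Longrightarrow> continuous_map X T (\<lambda>x. snd (f x))"
  by (simp_all add: continuous_R_iff)

text \<open>
  Continuity of \<open>g \<mapsto> h.g\<close> makes the left translations of \<open>P\<close> continuous, and continuity of \<open>h \<mapsto> h.g\<close>
  the right translations. Inversion is equivariant since \<open>x\<inverse> = (a x)\<inverse> a\<close>, and its graph is closed
  because its composition with the injection \<open>(g, h) \<mapsto> (\<psi> g, h)\<close> into \<open>H \<times> H\<close> is
  \<open>(g, h) \<mapsto> (h\<inverse> (\<psi> g)\<inverse> h, h\<inverse>)\<close>.
\<close>

lemma continuous_inv_P: "continuous_map R R (\<lambda>x. inv\<^bsub>P\<^esub> x)"
proof (rule equivariant_closed_graph_imp_continuous[OF P.group_axioms topspace_R])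
  show "completely_metrizable_space R" "separable_space R"
    "completely_metrizable_space R" "separable_space R"
    using polish_G polish_H
    by (simp_all add: polish_group_def completely_metrizable_space_prod_topology
        separable_space_prod_topology)
  note rules = continuous_rules continuous_comp_fst_R continuous_comp_snd_R
  show "continuous_map R R (\<lambda>x. a \<otimes>\<^bsub>P\<^esub> x)" if a: "a \<in> carrier P" for a
  proof -
    have "continuous_map R S (\<lambda>x. act (snd a) (fst x))"
      using a continuous_map_compose[OF continuous_map_fst continuous_act]
      by (auto simp: o_def carrier_P)
    then show ?thesis
      unfolding continuous_R_iff mult_P fst_conv snd_conv using a
      by (intro conjI rules) (auto simp: carrier_P)
  qed
  show right: "continuous_map R R (\<lambda>x. x \<otimes>\<^bsub>P\<^esub> a)" if a: "a \<in> carrier P" for a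
  proof -
    have "continuous_map R S (\<lambda>x. act (snd x) (fst a))"
      using a continuous_map_compose[OF continuous_map_snd continuous_orbit_map]
      by (auto simp: o_def carrier_P)
    then show ?thesis
      unfolding continuous_R_iff mult_P fst_conv snd_conv using a
      by (intro conjI rules) (auto simp: carrier_P)
  qed
  show "(\<lambda>x. inv\<^bsub>P\<^esub> x) \<in> topspace R \<rightarrow> topspace R"
    unfolding topspace_R by simp
  show "closedin (prod_topology R R) ((\<lambda>x. (x, inv\<^bsub>P\<^esub> x)) ` topspace R)"
  proof (rule closed_graph_if_injection_comp_continuous)
    let ?\<phi> = "\<lambda>x. (\<psi> (fst x), snd x)"
    show "Hausdorff_space (prod_topology T T)"
      using Hausdorff_T by (simp add: Hausdorff_space_prod_topology)
    show "continuous_map R (prod_topology T T) ?\<phi>"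
      unfolding continuous_map_paired by (intro conjI rules)
    show "inj_on ?\<phi> (topspace R)"
      by (auto simp: inj_on_def inj topspace_S)
    show "(\<lambda>x. inv\<^bsub>P\<^esub> x) \<in> topspace R \<rightarrow> topspace R"
      unfolding topspace_R by simp
    have "continuous_map R (prod_topology T T)
        (\<lambda>x. (inv\<^bsub>H\<^esub> snd x \<otimes>\<^bsub>H\<^esub> \<psi> (inv\<^bsub>G\<^esub> fst x) \<otimes>\<^bsub>H\<^esub> snd x, inv\<^bsub>H\<^esub> snd x))"
      unfolding continuous_map_paired by (intro conjI rules)
    then show "continuous_map R (prod_topology T T) (\<lambda>x. ?\<phi> (inv\<^bsub>P\<^esub> x))"
      by (rule continuous_map_eq) (auto simp: topspace_S topspace_T inv_P carrier_P)
  qed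
  show "\<exists>\<tau>. continuous_map R R \<tau> \<and> (\<forall>x\<in>carrier P. \<tau> (inv\<^bsub>P\<^esub> (a \<otimes>\<^bsub>P\<^esub> x)) = inv\<^bsub>P\<^esub> x)"
    if a: "a \<in> carrier P" for a
    using a right[OF a] by (intro exI[of _ "\<lambda>y. y \<otimes>\<^bsub>P\<^esub> a"]) (simp add: P.inv_mult_group P.m_assoc)
qed

text \<open>
  \<open>h.g\<close> is the first component of \<open>(g\<inverse>, h\<inverse>)\<inverse>\<close> in the semidirect product.
\<close>

lemma continuous_act_jointly:
  assumes "continuous_map X T k" "continuous_map X S f"
  shows "continuous_map X S (\<lambda>x. act (k x) (f x))"
proof -
  have "continuous_map X R (\<lambda>x. (inv\<^bsub>G\<^esub> f x, inv\<^bsub>H\<^esub> k x))"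
    unfolding continuous_map_paired using assms by (intro conjI continuous_rules)
  then have "continuous_map X R (\<lambda>x. inv\<^bsub>P\<^esub> (inv\<^bsub>G\<^esub> f x, inv\<^bsub>H\<^esub> k x))"
    using continuous_map_compose[OF _ continuous_inv_P] by (simp add: o_def)
  then have "continuous_map X S (\<lambda>x. fst (inv\<^bsub>P\<^esub> (inv\<^bsub>G\<^esub> f x, inv\<^bsub>H\<^esub> k x)))"
    by (rule continuous_comp_fst_R)
  then show ?thesis
  proof (rule continuous_map_eq)
    fix x assume "x \<in> topspace X"
    then have "f x \<in> carrier G" "k x \<in> carrier H"
      using assms by (auto simp: continuous_map_def topspace_S topspace_T)
    then show "fst (inv\<^bsub>P\<^esub> (inv\<^bsub>G\<^esub> f x, inv\<^bsub>H\<^esub> k x)) = act (k x) (f x)"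
      by (simp add: inv_P carrier_P)
  qed
qed

lemma polish_group_P: "polish_group P R"
proof -
  have "continuous_map (prod_topology R R) R (\<lambda>p. fst p \<otimes>\<^bsub>P\<^esub> snd p)"
    unfolding continuous_R_iff mult_P fst_conv snd_conv
    by (intro conjI continuous_rules continuous_act_jointly continuous_comp_fst_R
        continuous_comp_snd_R continuous_map_fst continuous_map_snd)
  then show ?thesis
    using polish_G polish_H continuous_inv_P
    by (simp add: polish_group_def topological_group_def group_P topspace_R case_prod_unfold
        completely_metrizable_space_prod_topology separable_space_prod_topology del: topspace_prod_topology)
qed

abbreviation \<pi> where "\<pi> \<equiv> semidirect_proj H \<psi>"

abbreviation \<iota> :: "'a \<Rightarrow> 'a \<times> 'b" where "\<iota> \<equiv> semidirect_incl H"

abbreviation K where "K \<equiv> kernel P H \<pi>"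

lemma proj_apply: "\<pi> x = \<psi> (fst x) \<otimes>\<^bsub>H\<^esub> snd x"
  by (simp add: semidirect_proj_def case_prod_beta)

lemma continuous_proj: "continuous_map R T \<pi>"
  unfolding proj_apply
  by (intro continuous_rules continuous_map_fst continuous_map_snd)

lemma proj_hom: "group_hom P H \<pi>"
  by unfold_locales
    (auto simp: hom_def proj_apply carrier_P mult_P H.m_assoc)

lemma proj_surj: "\<pi> ` carrier P = carrier H"
proof
  show "carrier H \<subseteq> \<pi> ` carrier P"
  proof
    fix h assume "h \<in> carrier H"
    then show "h \<in> \<pi> ` carrier P"
      by (intro image_eqI[of _ _ "(\<one>\<^bsub>G\<^esub>, h)"]) (simp_all add: proj_apply carrier_P)
  qed
qed (auto simp: proj_apply carrier_P)

lemma kernel_proj: "K = {(inv\<^bsub>G\<^esub> g, \<psi> g) | g. g \<in> carrier G}"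
proof (intro equalityI subsetI)
  fix x assume x: "x \<in> K"
  then have "fst x \<in> carrier G" "snd x \<in> carrier H" "\<psi> (fst x) \<otimes>\<^bsub>H\<^esub> snd x = \<one>\<^bsub>H\<^esub>"
    by (auto simp: kernel_def carrier_P proj_apply)
  moreover from this have "\<psi> (inv\<^bsub>G\<^esub> (fst x)) = snd x"
    by (simp add: H.inv_equality H.inv_comm)
  ultimately show "x \<in> {(inv\<^bsub>G\<^esub> g, \<psi> g) | g. g \<in> carrier G}"
    by (intro CollectI exI[of _ "inv\<^bsub>G\<^esub> (fst x)"]) (auto simp: prod_eq_iff)
qed (auto simp: kernel_def carrier_P proj_apply)

text \<open>
  The inverse isomorphism is \<open>g \<mapsto> (g\<inverse>, \<psi> g)\<close>; it is multiplicative because \<open>\<psi> g\<close> acts on \<open>G\<close> as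
  conjugation by \<open>g\<close>.
\<close>

lemma kernel_isomorphic: "isomorphic_topological_groups (P\<lparr>carrier := K\<rparr>) (subtopology R K) G S"
  unfolding isomorphic_topological_groups_def
proof (intro exI conjI)
  let ?f = "\<lambda>x. inv\<^bsub>G\<^esub> (fst x)" and ?g = "\<lambda>g. (inv\<^bsub>G\<^esub> g, \<psi> g)"
  have "continuous_map (subtopology R K) S ?f"
    by (intro continuous_rules continuous_map_from_subtopology continuous_map_fst)
  moreover have "continuous_map S R ?g"
    unfolding continuous_map_paired by (intro conjI continuous_rules)
  then have "continuous_map S (subtopology R K) ?g"
    by (auto simp: continuous_map_in_subtopology kernel_proj topspace_S)
  ultimately have maps: "homeomorphic_maps (subtopology R K) S ?f ?g"
    by (auto simp: homeomorphic_maps_def kernel_proj topspace_S)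
  then show homeo: "homeomorphic_map (subtopology R K) S ?f"
    by (rule homeomorphic_maps_imp_map)
  have "topspace (subtopology R K) = K"
    by (auto simp: topspace_R kernel_def simp del: topspace_prod_topology)
  then have "bij_betw ?f K (carrier G)"
    using homeomorphic_imp_surjective_map[OF homeo] homeomorphic_imp_injective_map[OF homeo]
    by (simp add: topspace_S bij_betw_def)
  moreover have "?f (x \<otimes>\<^bsub>P\<^esub> y) = ?f x \<otimes>\<^bsub>G\<^esub> ?f y" if "x \<in> K" "y \<in> K" for x y
    using that by (auto simp: kernel_proj mult_P act_\<psi> G.inv_mult_group G.m_assoc)
  ultimately show "?f \<in> iso (P\<lparr>carrier := K\<rparr>) G"
    by (auto simp: iso_def hom_def bij_betw_def)
qed

lemma proj_incl: "g \<in> carrier G \<Longrightarrow> \<pi> (\<iota> g) = \<psi> g"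
  by (simp add: proj_apply semidirect_incl_def)

lemma range_incl: "\<iota> ` carrier G = carrier G \<times> {\<one>\<^bsub>H\<^esub>}"
  by (auto simp: semidirect_incl_def)

text \<open>
  Since \<open>(a b, 1) (b\<inverse>, \<psi> b) = (a, \<psi> b)\<close>, density of the product of the two subgroups reduces
  to density of the image of \<open>\<psi>\<close> in \<open>H\<close>.
\<close>

lemma incl_set_mult_kernel: "\<iota> ` carrier G <#>\<^bsub>P\<^esub> K = carrier G \<times> \<psi> ` carrier G"
proof (intro equalityI subsetI)
  fix x assume "x \<in> carrier G \<times> \<psi> ` carrier G"
  then obtain a b where ab: "a \<in> carrier G" "b \<in> carrier G" and x: "x = (a, \<psi> b)"
    by auto
  then have "x = \<iota> (a \<otimes>\<^bsub>G\<^esub> b) \<otimes>\<^bsub>P\<^esub> (inv\<^bsub>G\<^esub> b, \<psi> b)"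
    by (simp add: mult_P semidirect_incl_def act_one G.m_assoc)
  with ab show "x \<in> \<iota> ` carrier G <#>\<^bsub>P\<^esub> K"
    by (auto simp: set_mult_def kernel_proj)
qed (auto simp: set_mult_def range_incl kernel_proj mult_P act_one)

lemma closure_incl_kernel: "R closure_of (\<iota> ` carrier G <#>\<^bsub>P\<^esub> K) = carrier P"
proof -
  have "S closure_of carrier G = carrier G" "T closure_of (\<psi> ` carrier G) = carrier H"
    using compression closure_of_topspace[of S]
    by (simp_all add: topspace_S topspace_T normal_compression_def)
  then show ?thesis
    unfolding incl_set_mult_kernel by (simp add: closure_of_Times carrier_P)
qed

lemma closedin_incl: "closedin R (\<iota> ` carrier G)"
proof -
  have "closedin T {\<one>\<^bsub>H\<^esub>}"
    using Hausdorff_T by (simp add: closedin_Hausdorff_singleton topspace_T)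
  moreover have "closedin S (carrier G)"
    using closedin_topspace[of S] by (simp add: topspace_S)
  ultimately show ?thesis
    by (simp add: range_incl closedin_prod_Times_iff)
qed

lemma normal_incl: "\<iota> ` carrier G \<lhd> P"
proof -
  interpret snd: group_hom P H snd
    by unfold_locales (auto simp: hom_def carrier_P mult_P)
  have "\<iota> ` carrier G = kernel P H snd"
    by (auto simp: range_incl kernel_def carrier_P)
  then show ?thesis
    using snd.normal_kernel by simp
qed

lemma closedin_kernel: "closedin R K"
  using closedin_continuous_maps_eq[OF Hausdorff_T continuous_proj continuous_const_H[OF H.one_closed]]
  unfolding topspace_R kernel_def .

lemma incl_Int_kernel: "\<iota> ` carrier G \<inter> K = {\<one>\<^bsub>P\<^esub>}"
proof -
  have "g = \<one>\<^bsub>G\<^esub>" if "g \<in> carrier G" "\<psi> g = \<one>\<^bsub>H\<^esub>" for g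
    using that inj[of g "\<one>\<^bsub>G\<^esub>"] by simp
  then show ?thesis
    by (auto simp: range_incl kernel_def carrier_P one_P proj_apply)
qed

end

theorem theorem1p3:
  fixes G :: "('a, 'm) monoid_scheme" and S :: "'a topology"
    and H :: "('b, 'n) monoid_scheme" and T :: "'b topology"
    and \<psi> :: "'a \<Rightarrow> 'b"
  assumes "polish_group G S" and "polish_group H T"
    and "normal_compression G S H T \<psi>"
  shows "let P = semidirect G H \<psi>; R = prod_topology S T;
             \<pi> = semidirect_proj H \<psi>; \<iota> = semidirect_incl H;
             K = kernel P H \<pi>; I = \<iota> ` carrier G
         in polish_group P R \<and>
            (continuous_map R T \<pi> \<and> \<pi> \<in> hom P H \<and> \<pi> ` carrier P = carrier H \<and>
             K = {(inv\<^bsub>G\<^esub> g, \<psi> g) | g. g \<in> carrier G} \<and>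
             isomorphic_topological_groups (P\<lparr>carrier := K\<rparr>) (subtopology R K) G S) \<and>
            (\<forall>g \<in> carrier G. \<psi> g = (\<pi> \<circ> \<iota>) g) \<and>
            (carrier P = R closure_of (I <#>\<^bsub>P\<^esub> K) \<and>
             closedin R I \<and> I \<lhd> P \<and> closedin R K \<and> K \<lhd> P \<and> I \<inter> K = {\<one>\<^bsub>P\<^esub>})"
proof -
  interpret polish_compression G S H T \<psi>
    using assms by unfold_locales
  show ?thesis
    unfolding Let_def
    using polish_group_P continuous_proj group_hom.homh[OF proj_hom] proj_surj kernel_proj
      kernel_isomorphic proj_incl closure_incl_kernel closedin_incl normal_incl closedin_kernel
      group_hom.normal_kernel[OF proj_hom] incl_Int_kernel
    by (intro conjI ballI) (simp_all only: o_apply)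
qed

end
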